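(* Let $H$ be a fixed graph and let $\mathcal{C}$ be a class of graphs such that no graph in $\mathcal{C}$ contains $H$ as a minor. Suppose that the maximum degree in $\mathcal{C}$ is sublinear in the number of edges, that is, for every $\delta>0$ there exists $m_\delta$ such that every graph $G\in\mathcal{C}$ with $m\geq m_\delta$ edges satisfies $\Delta(G)\leq\delta m$. Then $\mathcal{C}$ is maximally modular, that is, for every $\varepsilon>0$ there exists $M_\varepsilon$ such that every graph $G\in\mathcal{C}$ with $m\geq M_\varepsilon$ edges satisfies $\operatorname{mod}(G)>1-\varepsilon$.
   Context: All graphs are finite, simple and undirected. For a graph $G$, $V(G)$ and $E(G)$ denote its vertex and edge sets, $\deg(v)$ is the degree of the vertex $v$ in $G$, $\Delta(G)$ is the maximum degree, and for $S\subseteq V(G)$ we write $\deg(S)=\sum_{v\in S}\deg(v)$ (degrees taken in $G$). Modularity: let $G$ be a graph with at least one edge. For a partition $\mathcal{A}$ of $G$ into induced subgraphs (i.e. the vertex sets $V(A)$, $A\in\mathcal{A}$, form a partition of $V(G)$, and each $A$ is the subgraph of $G$ induced by $V(A)$, with $E(A)$ the set of edges of $G$ having both ends in $V(A)$) define $$\operatorname{mod}_{\mathcal{A}}(G)=\sum_{A\in\mathcal{A}}\left(\frac{|E(A)|}{|E(G)|}-\left(\frac{\deg(V(A))}{\deg(V(G))}\right)^2\right),$$ and set $\operatorname{mod}(G)=\max_{\mathcal{A}}\operatorname{mod}_{\mathcal{A}}(G)$, the maximum being over all such partitions. By convention a graph with no edges has modularity $0$. *)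

theory Defs
  imports Complex_Main "HOL-Library.Disjoint_Sets"
begin

datatype 'a graph = Graph (verts: "'a set") (edges: "'a set set")

definition simple_graph :: "'a graph \<Rightarrow> bool" where
  "simple_graph G \<longleftrightarrow>
     finite (verts G) \<and> (\<forall>e \<in> edges G. e \<subseteq> verts G \<and> card e = 2)"

definition induced_subgraph :: "'a graph \<Rightarrow> 'a set \<Rightarrow> 'a graph" where
  "induced_subgraph G S = Graph S {e \<in> edges G. e \<subseteq> S}"

definition degree :: "'a graph \<Rightarrow> 'a \<Rightarrow> nat" where
  "degree G v = card {e \<in> edges G. v \<in> e}"

definition degree_sum :: "'a graph \<Rightarrow> 'a set \<Rightarrow> nat" where
  "degree_sum G S = (\<Sum>v\<in>S. degree G v)"

text \<open>Inserting 0 only matters for the graph without vertices, whose maximum degree is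
  thereby 0.\<close>

definition max_degree :: "'a graph \<Rightarrow> nat" where
  "max_degree G = Max (insert 0 (degree G ` verts G))"

text \<open>As usual, the graph without vertices does not count as connected.\<close>

definition connected_graph :: "'a graph \<Rightarrow> bool" where
  "connected_graph G \<longleftrightarrow>
     verts G \<noteq> {} \<and>
     (\<forall>u \<in> verts G. \<forall>v \<in> verts G. (u, v) \<in> {(x, y). {x, y} \<in> edges G}\<^sup>*)"

text \<open>The graph \<open>H\<close> is a minor of \<open>G\<close> if it arises from a subgraph of \<open>G\<close> by contracting
  edges: the set \<open>B x\<close> consists of the vertices of \<open>G\<close> that are contracted to the vertex
  \<open>x\<close> of \<open>H\<close>. Vertices of \<open>G\<close> outside all branch sets are deleted, and so are superfluous
  edges, so \<open>G\<close> may have edges between branch sets of non-adjacent vertices.\<close>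

definition is_minor :: "'b graph \<Rightarrow> 'a graph \<Rightarrow> bool" where
  "is_minor H G \<longleftrightarrow>
     (\<exists>B :: 'b \<Rightarrow> 'a set.
        (\<forall>x \<in> verts H. B x \<subseteq> verts G \<and> connected_graph (induced_subgraph G (B x))) \<and>
        disjoint_family_on B (verts H) \<and>
        (\<forall>x y. {x, y} \<in> edges H \<longrightarrow> (\<exists>u \<in> B x. \<exists>v \<in> B y. {u, v} \<in> edges G)))"

text \<open>A partition into induced subgraphs is represented by the partition of the vertex
  set.\<close>

definition partition_modularity :: "'a graph \<Rightarrow> 'a set set \<Rightarrow> real" where
  "partition_modularity G P =
     (\<Sum>A\<in>P. real (card (edges (induced_subgraph G A))) / real (card (edges G))
            - (real (degree_sum G A) / real (degree_sum G (verts G)))\<^sup>2)"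

definition modularity :: "'a graph \<Rightarrow> real" where
  "modularity G =
     (if edges G = {} then 0
      else Max (partition_modularity G ` {P. partition_on (verts G) P}))"

lemma partitions_finite_nonempty:
  assumes "simple_graph G"
  shows "finite {P. partition_on (verts G) P}" and "{P. partition_on (verts G) P} \<noteq> {}"
proof -
  show "finite {P. partition_on (verts G) P}"
    using assms by (auto simp: simple_graph_def intro: finitely_many_partition_on)
  have "partition_on (verts G) ({verts G} - {{}})"
    by (auto simp: partition_on_def pairwise_def)
  then show "{P. partition_on (verts G) P} \<noteq> {}" by blast
qed

end

theory Submission
  imports Defs
begin

text \<open>Weight vertices by their degrees. Suppose that every set of small weight leaves a connected
  piece carrying more than half of the total weight. In the style of Alon, Seymour and Thomas, keep
  a heavy component \<open>B\<close> together with pairwise adjacent branch sets whose boundaries towards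
  \<open>B\<close> are cheap, and choose them with \<open>B\<close> minimal. Either a tree with boundedly many vertices
  inside \<open>B\<close> touches all branch sets and becomes a new branch set (it is cheap because the maximum
  degree is sublinear), or a cheap union of breadth-first layers cuts the heavy part of \<open>B\<close>
  off from one branch set, which is then enlarged. Both shrink \<open>B\<close>, so one ends up with a clique
  minor of order \<open>|V(H)|\<close>. Hence cheap balanced separators exist; iterating them gives a set \<open>X\<close> of
  small degree sum whose removal leaves only pieces of small degree sum. Those pieces and the
  singletons of \<open>X\<close> form a partition of modularity close to 1.\<close>

section \<open>Connected sets and components\<close>

text \<open>Stated for a bare relation, so that passing to an induced subgraph is just
  \<open>Restr\<close>; excluding the empty set matches \<open>connected_graph\<close>.\<close>

definition conn :: "'a rel \<Rightarrow> 'a set \<Rightarrow> bool" where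
  "conn E S \<longleftrightarrow> S \<noteq> {} \<and> (\<forall>u\<in>S. \<forall>v\<in>S. (u, v) \<in> (Restr E S)\<^sup>*)"

text \<open>Closure under neighbours in \<open>S\<close> stands for maximality, because it can be
  rechecked edge by edge when \<open>S\<close> changes.\<close>

definition component :: "'a rel \<Rightarrow> 'a set \<Rightarrow> 'a set \<Rightarrow> bool" where
  "component E S K \<longleftrightarrow> conn E K \<and> K \<subseteq> S \<and> E `` K \<inter> S \<subseteq> K"

text \<open>A path inside \<open>D\<close> that starts in \<open>T\<close> never leaves
  \<open>T\<close>.\<close>

lemma conn_subset_closed:
  assumes "conn E D" "D \<inter> T \<noteq> {}"
    and closed: "\<And>x y. x \<in> D \<Longrightarrow> x \<in> T \<Longrightarrow> y \<in> D \<Longrightarrow> (x, y) \<in> E \<Longrightarrow> y \<in> T"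
  shows "D \<subseteq> T"
proof
  fix y assume "y \<in> D"
  obtain x where x: "x \<in> D" "x \<in> T" using assms(2) by blast
  have "(x, y) \<in> (Restr E D)\<^sup>*" using assms(1) x(1) \<open>y \<in> D\<close> by (simp add: conn_def)
  then show "y \<in> T"
    by (induction rule: rtrancl_induct) (use x closed in auto)
qed

lemma conn_subset_component:
  assumes "conn E D" "D \<subseteq> S" "component E S K" "D \<inter> K \<noteq> {}"
  shows "D \<subseteq> K"
  using assms by (intro conn_subset_closed[of E D K]) (auto simp: component_def)

lemma conn_rooted:
  assumes "sym E" "c \<in> S" "\<And>v. v \<in> S \<Longrightarrow> (c, v) \<in> (Restr E S)\<^sup>*"
  shows "conn E S"
proof -
  have "sym (Restr E S)" using assms(1) by (auto simp: sym_def)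
  then have "sym ((Restr E S)\<^sup>*)" by (rule sym_rtrancl)
  then have "(u, v) \<in> (Restr E S)\<^sup>*" if "u \<in> S" "v \<in> S" for u v
    using assms(3)[OF that(1)] assms(3)[OF that(2)] by (meson rtrancl_trans symD)
  then show ?thesis using assms(2) by (auto simp: conn_def)
qed

lemma conn_singleton: "conn E {v}"
  by (simp add: conn_def)

lemma conn_reach_mono:
  assumes "conn E S" "S \<subseteq> T" "u \<in> S" "v \<in> S"
  shows "(u, v) \<in> (Restr E T)\<^sup>*"
proof -
  have "Restr E S \<subseteq> Restr E T" using assms(2) by auto
  then show ?thesis using assms rtrancl_mono unfolding conn_def by blast
qed

lemma conn_Union:
  assumes "sym E" "\<And>i. i \<in> I \<Longrightarrow> conn E (T i) \<and> c \<in> T i"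
  shows "conn E (insert c (\<Union>i\<in>I. T i))"
proof (rule conn_rooted[OF assms(1), of c])
  fix v assume "v \<in> insert c (\<Union>i\<in>I. T i)"
  then consider "v = c" | i where "i \<in> I" "v \<in> T i" by auto
  then show "(c, v) \<in> (Restr E (insert c (\<Union>i\<in>I. T i)))\<^sup>*"
  proof cases
    case 2
    then show ?thesis using assms(2) by (intro conn_reach_mono[of E "T i"]) auto
  qed simp
qed simp

lemma conn_insert:
  assumes "sym E" "conn E S" "u \<in> S" "(u, v) \<in> E"
  shows "conn E (insert v S)"
proof (rule conn_rooted[OF assms(1), of u])
  fix x assume "x \<in> insert v S"
  then show "(u, x) \<in> (Restr E (insert v S))\<^sup>*"
  proof
    assume "x = v"
    then show ?thesis using assms by auto
  next
    assume "x \<in> S"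
    then show ?thesis using assms by (intro conn_reach_mono[of E S]) auto
  qed
qed (use assms in simp)

lemma component_exists:
  assumes "sym E" "v \<in> S"
  obtains K where "component E S K" "v \<in> K"
proof
  let ?K = "(Restr E S)\<^sup>* `` {v}"
  have sub: "?K \<subseteq> S"
  proof
    fix x assume "x \<in> ?K"
    then have "(v, x) \<in> (Restr E S)\<^sup>*" by simp
    then show "x \<in> S" by (induction rule: rtrancl_induct) (use assms in auto)
  qed
  have "conn E ?K"
  proof (rule conn_rooted[OF assms(1), of v])
    fix x assume "x \<in> ?K"
    then have "(v, x) \<in> (Restr E S)\<^sup>*" by simp
    then show "(v, x) \<in> (Restr E ?K)\<^sup>*"
    proof (induction rule: rtrancl_induct)
      case (step y z)
      have "(v, z) \<in> (Restr E S)\<^sup>*" using step(1,2) by (rule rtrancl_into_rtrancl)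
      then have "(y, z) \<in> Restr E ?K" using step(1,2) by auto
      with step(3) show ?case by (rule rtrancl_into_rtrancl)
    qed simp
  qed simp
  moreover have "E `` ?K \<inter> S \<subseteq> ?K"
  proof
    fix y assume "y \<in> E `` ?K \<inter> S"
    then obtain x where x: "(v, x) \<in> (Restr E S)\<^sup>*" "(x, y) \<in> E" "y \<in> S" by auto
    then have "(x, y) \<in> Restr E S" using sub by auto
    with x(1) show "y \<in> ?K" by (auto intro: rtrancl_into_rtrancl)
  qed
  ultimately show "component E S ?K" using sub by (simp add: component_def)
qed simp

lemma conn_in_component:
  assumes "sym E" "conn E D" "D \<subseteq> S"
  obtains K where "component E S K" "D \<subseteq> K"
proof -
  obtain v where "v \<in> D" using assms(2) by (auto simp: conn_def)
  then obtain K where "component E S K" "v \<in> K" using component_exists[OF assms(1)] assms(3) by blast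
  then show ?thesis using that conn_subset_component[OF assms(2,3)] \<open>v \<in> D\<close> by blast
qed

lemma components_partition:
  assumes "sym E"
  shows "partition_on S {K. component E S K}"
proof (rule partition_onI)
  show "\<Union>{K. component E S K} = S"
  proof
    show "\<Union>{K. component E S K} \<subseteq> S" by (auto simp: component_def)
    show "S \<subseteq> \<Union>{K. component E S K}"
    proof
      fix v assume "v \<in> S"
      then obtain K where "component E S K" "v \<in> K" by (rule component_exists[OF assms])
      then show "v \<in> \<Union>{K. component E S K}" by blast
    qed
  qed
  show "disjnt K K'" if "K \<in> {K. component E S K}" "K' \<in> {K. component E S K}" "K \<noteq> K'" for K K'
  proof (rule ccontr)
    assume "\<not> disjnt K K'"
    then have "K \<inter> K' \<noteq> {}" "K' \<inter> K \<noteq> {}" by (auto simp: disjnt_def)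
    then have "K \<subseteq> K'" "K' \<subseteq> K"
      using that conn_subset_component[of E _ S] by (auto simp: component_def)
    then show False using that by auto
  qed
qed (auto simp: component_def conn_def)

lemma sum_UN_le:
  fixes w :: "'a \<Rightarrow> real"
  assumes "finite I" "\<And>v. 0 \<le> w v" "\<And>i. i \<in> I \<Longrightarrow> finite (A i)"
  shows "sum w (\<Union>i\<in>I. A i) \<le> (\<Sum>i\<in>I. sum w (A i))"
  using assms(1,3)
proof (induction I)
  case (insert i I)
  have "sum w (A i \<union> (\<Union>i\<in>I. A i)) \<le> sum w (A i) + sum w (\<Union>i\<in>I. A i)"
    using insert assms(2) by (subst sum_Un) (auto intro: sum_nonneg)
  then show ?case using insert by simp
qed simp

section \<open>Breadth-first layers\<close>

fun nball :: "'a rel \<Rightarrow> 'a set \<Rightarrow> 'a set \<Rightarrow> nat \<Rightarrow> 'a set" where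
  "nball E B A 0 = A"
| "nball E B A (Suc d) = nball E B A d \<union> (E `` nball E B A d \<inter> B)"

lemma nball_mono: "d \<le> e \<Longrightarrow> nball E B A d \<subseteq> nball E B A e"
  by (induction e rule: dec_induct) auto

lemma nball_subset: "A \<subseteq> B \<Longrightarrow> nball E B A d \<subseteq> B"
  by (induction d) auto

text \<open>Retracing the growth steps leads from \<open>v\<close> back to \<open>A\<close>, with at
  most one new vertex per step. Only the vertex set is kept, since connectedness and size are all
  that matters later.\<close>

lemma nball_path:
  assumes "sym E" "A \<subseteq> B" "v \<in> nball E B A d"
  shows "\<exists>T\<subseteq>B. conn E T \<and> v \<in> T \<and> T \<inter> A \<noteq> {} \<and> finite T \<and> card T \<le> d + 1"
  using assms(3)
proof (induction d arbitrary: v)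
  case 0
  then show ?case using assms(2) by (intro exI[of _ "{v}"]) (auto simp: conn_singleton)
next
  case (Suc d)
  consider "v \<in> nball E B A d" | u where "u \<in> nball E B A d" "(u, v) \<in> E" "v \<in> B"
    using Suc.prems by auto
  then show ?case
  proof cases
    case 1
    from Suc.IH[OF 1] obtain T
      where "T \<subseteq> B" "conn E T" "v \<in> T" "T \<inter> A \<noteq> {}" "finite T" "card T \<le> d + 1"
      by (elim exE conjE)
    then show ?thesis by (intro exI[of _ T]) simp
  next
    case 2
    from Suc.IH[OF 2(1)] obtain T
      where T: "T \<subseteq> B" "conn E T" "u \<in> T" "T \<inter> A \<noteq> {}" "finite T" "card T \<le> d + 1"
      by (elim exE conjE)
    have "card (insert v T) \<le> Suc d + 1" using T(5,6) by (simp add: card_insert_if)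
    moreover have "conn E (insert v T)" using conn_insert[OF assms(1) T(2,3) 2(2)] .
    moreover have "insert v T \<subseteq> B" "insert v T \<inter> A \<noteq> {}" "finite (insert v T)"
      using T(1,4,5) 2(3) by auto
    ultimately show ?thesis by blast
  qed
qed

text \<open>The first \<open>L\<close> layers are disjoint subsets of \<open>B\<close>, so they
  cannot all exceed the average.\<close>

lemma light_layer:
  fixes w :: "'a \<Rightarrow> real"
  assumes "finite B" "A \<subseteq> B" "0 < L" "\<And>v. 0 \<le> w v"
  shows "\<exists>d<L. sum w (nball E B A (Suc d) - nball E B A d) \<le> sum w B / real L"
proof (rule ccontr)
  let ?l = "\<lambda>d. nball E B A (Suc d) - nball E B A d"
  assume "\<not> ?thesis"
  then have "\<And>d. d < L \<Longrightarrow> sum w B / L < sum w (?l d)" by force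
  then have "(\<Sum>d<L. sum w B / L) < (\<Sum>d<L. sum w (?l d))"
    using assms(3) by (intro sum_strict_mono) auto
  moreover have "(\<Sum>d<L. sum w (?l d)) = sum w (\<Union>d<L. ?l d)"
  proof (rule sum.UNION_disjoint[symmetric])
    show "\<forall>i\<in>{..<L}. finite (?l i)"
      using nball_subset[OF assms(2)] assms(1) by (meson finite_Diff finite_subset)
    have "?l i \<inter> ?l j = {}" if "i < j" for i j
      using nball_mono[of "Suc i" j E B A] that by fastforce
    then show "\<forall>i\<in>{..<L}. \<forall>j\<in>{..<L}. i \<noteq> j \<longrightarrow> ?l i \<inter> ?l j = {}"
      by (metis Int_commute linorder_neqE_nat)
  qed simp
  moreover have "(\<Union>d<L. ?l d) \<subseteq> B" using nball_subset[OF assms(2)] by fast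
  then have "sum w (\<Union>d<L. ?l d) \<le> sum w B"
    using assms by (intro sum_mono2) auto
  ultimately show False using assms(3) by simp
qed

text \<open>Either some vertex is within \<open>L\<close> steps of every \<open>A i\<close>, and
  short paths from it unite to a small connected set, or every vertex is far from some
  \<open>A i\<close>. In the second case one light layer is removed around each \<open>A i\<close>;
  a connected set avoiding these layers has a vertex far from some \<open>A i\<close> and cannot
  cross the layer in between.\<close>

lemma tree_or_cut:
  fixes w :: "'a \<Rightarrow> real"
  assumes "sym E" "finite B" "B \<noteq> {}" "finite I" "0 < L" "\<And>v. 0 \<le> w v"
    and A: "\<And>i. i \<in> I \<Longrightarrow> A i \<subseteq> B"
  obtains (tree) T where "T \<subseteq> B" "conn E T" "card T \<le> card I * (L + 1) + 1"
      "\<And>i. i \<in> I \<Longrightarrow> T \<inter> A i \<noteq> {}"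
    | (cut) Z where "Z \<subseteq> B" "sum w Z \<le> card I * (sum w B / L)"
      "\<And>D. conn E D \<Longrightarrow> D \<subseteq> B - Z \<Longrightarrow> \<exists>i\<in>I. D \<inter> A i = {}"
proof (cases "\<exists>v\<in>B. \<forall>i\<in>I. v \<in> nball E B (A i) L")
  case True
  then obtain v where v: "v \<in> B" "\<And>i. i \<in> I \<Longrightarrow> v \<in> nball E B (A i) L" by blast
  have "\<forall>i\<in>I. \<exists>T\<subseteq>B. conn E T \<and> v \<in> T \<and> T \<inter> A i \<noteq> {} \<and> finite T \<and> card T \<le> L + 1"
    using nball_path[OF assms(1) A v(2)] by blast
  then obtain T where T: "\<And>i. i \<in> I \<Longrightarrow> T i \<subseteq> B \<and> conn E (T i) \<and> v \<in> T i \<and> T i \<inter> A i \<noteq> {} \<and>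
      finite (T i) \<and> card (T i) \<le> L + 1"
    by metis
  have "card (\<Union>i\<in>I. T i) \<le> (\<Sum>i\<in>I. card (T i))" by (rule card_UN_le[OF assms(4)])
  also have "\<dots> \<le> (\<Sum>i\<in>I. L + 1)" using T by (intro sum_mono) auto
  \<comment> \<open>Inserting \<open>v\<close> matters only for empty \<open>I\<close>, where the
    union is empty; hence the \<open>+ 1\<close>.\<close>
  finally have "card (insert v (\<Union>i\<in>I. T i)) \<le> card I * (L + 1) + 1"
    using T assms(4) by (simp add: card_insert_if)
  moreover have "conn E (insert v (\<Union>i\<in>I. T i))" using T by (intro conn_Union[OF assms(1)]) auto
  moreover have "insert v (\<Union>i\<in>I. T i) \<inter> A i \<noteq> {}" if "i \<in> I" for i using T[OF that] that by blast
  moreover have "insert v (\<Union>i\<in>I. T i) \<subseteq> B" using T v by blast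
  ultimately show ?thesis using tree by blast
next
  case False
  let ?l = "\<lambda>i d. nball E B (A i) (Suc d) - nball E B (A i) d"
  have "\<forall>i\<in>I. \<exists>d<L. sum w (?l i d) \<le> sum w B / L"
    using light_layer[where w = w, OF assms(2) A assms(5,6)] by blast
  then obtain d where d: "\<And>i. i \<in> I \<Longrightarrow> d i < L \<and> sum w (?l i (d i)) \<le> sum w B / L" by metis
  let ?Z = "\<Union>i\<in>I. ?l i (d i)"
  have sub: "?l i (d i) \<subseteq> B" if "i \<in> I" for i using nball_subset[OF A[OF that]] by fast
  show ?thesis
  proof (rule cut[of ?Z])
    show "?Z \<subseteq> B" using sub by blast
    have "sum w ?Z \<le> (\<Sum>i\<in>I. sum w (?l i (d i)))"
      using sub assms(2,4,6) by (intro sum_UN_le) (auto intro: finite_subset)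
    also have "\<dots> \<le> (\<Sum>i\<in>I. sum w B / L)" using d by (intro sum_mono) auto
    finally show "sum w ?Z \<le> card I * (sum w B / L)" by simp
    fix D assume D: "conn E D" "D \<subseteq> B - ?Z"
    then obtain v where v: "v \<in> D" "v \<in> B" by (auto simp: conn_def)
    then obtain i where i: "i \<in> I" "v \<notin> nball E B (A i) L" using False by blast
    \<comment> \<open>\<open>d i < L\<close> puts the removed layer within radius \<open>L\<close>,
      so \<open>v\<close> lies beyond it.\<close>
    have "v \<notin> nball E B (A i) (Suc (d i))" using nball_mono[of "Suc (d i)" L] d[OF i(1)] i(2) by fastforce
    then have "D \<subseteq> - nball E B (A i) (Suc (d i))"
    proof (intro conn_subset_closed[OF D(1)])
      fix x y assume xy: "x \<in> D" "x \<in> - nball E B (A i) (Suc (d i))" "y \<in> D" "(x, y) \<in> E"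
      show "y \<in> - nball E B (A i) (Suc (d i))"
      proof
        assume "y \<in> nball E B (A i) (Suc (d i))"
        \<comment> \<open>As \<open>D\<close> avoids the layer, \<open>y\<close> would lie in the
          inner ball, and its neighbour \<open>x\<close> then in the next one.\<close>
        then have "y \<in> nball E B (A i) (d i)" using xy(3) D(2) i(1) by blast
        moreover have "(y, x) \<in> E" using xy(4) assms(1) by (simp add: symD)
        ultimately show False using xy(1,2) D(2) by auto
      qed
    qed (use v in blast)
    moreover have "A i \<subseteq> nball E B (A i) (Suc (d i))" using nball_mono[of 0 "Suc (d i)" E B "A i"] by simp
    ultimately have "D \<inter> A i = {}" by blast
    then show "\<exists>i\<in>I. D \<inter> A i = {}" using i(1) by blast
  qed
qed

section \<open>Balanced separators\<close>

text \<open>A model of the complete graph on \<open>I\<close>: with all pairs adjacent, the edges of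
  \<open>H\<close> need not be tracked.\<close>

definition branch_sets :: "'a rel \<Rightarrow> 'a set \<Rightarrow> 'b set \<Rightarrow> ('b \<Rightarrow> 'a set) \<Rightarrow> bool" where
  "branch_sets E W I C \<longleftrightarrow>
     (\<forall>i\<in>I. conn E (C i) \<and> C i \<subseteq> W) \<and>
     (\<forall>i\<in>I. \<forall>j\<in>I. i \<noteq> j \<longrightarrow> C i \<inter> C j = {} \<and> E `` C i \<inter> C j \<noteq> {})"

lemma branch_sets_upd:
  assumes "sym E" "branch_sets E W I C" "conn E T" "T \<subseteq> W"
    and "\<And>j. j \<in> I - {i} \<Longrightarrow> C j \<inter> T = {} \<and> E `` C j \<inter> T \<noteq> {}"
  shows "branch_sets E W (insert i I) (C(i := T))"
proof -
  have "T \<inter> C j = {} \<and> E `` T \<inter> C j \<noteq> {}" if j: "j \<in> I - {i}" for j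
  proof -
    obtain x y where "x \<in> C j" "y \<in> T" "(x, y) \<in> E" using assms(5)[OF j] by blast
    moreover from this have "(y, x) \<in> E" using assms(1) by (simp add: symD)
    ultimately show ?thesis using assms(5)[OF j] by blast
  qed
  then show ?thesis using assms(2-5) by (simp add: branch_sets_def)
qed

text \<open>\<open>heavy\<close> is the failure of balanced separation, kept as a standing
  hypothesis until it yields a clique model on \<open>J\<close>. The budget allows each of the
  \<open>card J\<close> branch sets a boundary of weight \<open>r\<close>.\<close>

locale heavy_components =
  fixes E :: "'a rel" and W :: "'a set" and w :: "'a \<Rightarrow> real" and r :: real and J :: "'b set"
  assumes sym: "sym E" and fin: "finite W" "finite J"
    and nonneg: "\<And>v. 0 \<le> w v"
    and r_nonneg: "0 \<le> r"
    and heavy: "\<And>X. X \<subseteq> W \<Longrightarrow> sum w X \<le> card J * r \<Longrightarrow>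
      \<exists>B. component E (W - X) B \<and> sum w W < 2 * sum w B"
begin

text \<open>\<open>B\<close> is the heavy component left by the cheap boundaries \<open>X i\<close> of the branch sets \<open>C i\<close>;
  the branch sets themselves may be large.\<close>

definition state :: "'b set \<Rightarrow> ('b \<Rightarrow> 'a set) \<Rightarrow> ('b \<Rightarrow> 'a set) \<Rightarrow> 'a set \<Rightarrow> bool" where
  "state I C X B \<longleftrightarrow> I \<subseteq> J \<and> branch_sets E W I C \<and>
     (\<forall>i\<in>I. X i \<subseteq> C i \<and> sum w (X i) \<le> r \<and> C i \<inter> B = {}) \<and>
     component E (W - (\<Union>i\<in>I. X i)) B \<and> sum w W < 2 * sum w B"

text \<open>Disjoint sets cannot both carry more than half of the weight. This ties each new heavy
  component to the previous one.\<close>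

lemma heavy_intersect:
  assumes "A \<subseteq> W" "B \<subseteq> W" "sum w W < 2 * sum w A" "sum w W < 2 * sum w B"
  shows "A \<inter> B \<noteq> {}"
proof
  assume "A \<inter> B = {}"
  then have "sum w A + sum w B = sum w (A \<union> B)"
    using assms(1,2) fin finite_subset by (intro sum.union_disjoint[symmetric]) auto
  also have "\<dots> \<le> sum w W" using assms(1,2) fin nonneg by (intro sum_mono2) auto
  finally show False using assms(3,4) by simp
qed

lemma boundary_weight:
  assumes "finite I" "\<And>i. i \<in> I \<Longrightarrow> X i \<subseteq> W \<and> sum w (X i) \<le> r"
  shows "sum w (\<Union>i\<in>I. X i) \<le> card I * r"
proof -
  have "sum w (\<Union>i\<in>I. X i) \<le> (\<Sum>i\<in>I. sum w (X i))"
    using assms fin nonneg by (intro sum_UN_le) (auto intro: finite_subset)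
  also have "\<dots> \<le> (\<Sum>i\<in>I. r)" using assms by (intro sum_mono) auto
  finally show ?thesis by simp
qed

lemma state_initial: "\<exists>B. state {} (\<lambda>_. {}) (\<lambda>_. {}) B"
  using heavy[of "{}"] r_nonneg by (auto simp: state_def branch_sets_def)

text \<open>A branch set without neighbours in \<open>B\<close> has no boundary vertex adjacent to
  \<open>B\<close>, so giving up its boundary leaves \<open>B\<close> a component. Afterwards every
  remaining branch set touches \<open>B\<close>.\<close>

lemma state_drop:
  assumes "state I C X B"
  shows "state {i \<in> I. E `` C i \<inter> B \<noteq> {}} C X B" (is "state ?I C X B")
proof -
  have B: "component E (W - (\<Union>i\<in>I. X i)) B" and X: "\<And>i. i \<in> I \<Longrightarrow> X i \<subseteq> C i"
    using assms by (auto simp: state_def)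
  have "E `` B \<inter> (W - (\<Union>i\<in>?I. X i)) \<subseteq> B"
  proof
    fix y assume y: "y \<in> E `` B \<inter> (W - (\<Union>i\<in>?I. X i))"
    then obtain x where x: "x \<in> B" "(x, y) \<in> E" by blast
    then have "(y, x) \<in> E" using sym by (simp add: symD)
    then have "y \<notin> X i" if "i \<in> I" for i using that y X[OF that] x(1) by blast
    then show "y \<in> B" using y x B unfolding component_def by blast
  qed
  then have "component E (W - (\<Union>i\<in>?I. X i)) B" using B by (auto simp: component_def)
  then show ?thesis using assms by (auto simp: state_def branch_sets_def)
qed

text \<open>The new set \<open>T\<close> serves as its own boundary. The next heavy component still
  avoids the old boundaries and meets \<open>B\<close>, hence lies in \<open>B\<close>; it also
  avoids the non-empty \<open>T\<close>, so it is smaller.\<close>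

lemma state_extend:
  assumes st: "state I C X B" and "i \<in> J - I" and T: "conn E T" "T \<subseteq> B" "sum w T \<le> r"
    and touch: "\<And>j. j \<in> I \<Longrightarrow> E `` C j \<inter> T \<noteq> {}"
  shows "\<exists>I C X B'. state I C X B' \<and> B' \<subset> B"
proof -
  have I: "I \<subseteq> J" "finite I" using st fin finite_subset by (auto simp: state_def)
  have B: "component E (W - (\<Union>i\<in>I. X i)) B" "sum w W < 2 * sum w B"
    and C: "branch_sets E W I C"
    and X: "\<And>i. i \<in> I \<Longrightarrow> X i \<subseteq> C i \<and> sum w (X i) \<le> r \<and> C i \<inter> B = {}"
    using st by (auto simp: state_def)
  have BW: "B \<subseteq> W" using B by (auto simp: component_def)
  let ?X = "X(i := T)" and ?C = "C(i := T)"
  have C': "branch_sets E W (insert i I) ?C"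
    using T BW X touch by (intro branch_sets_upd[OF sym C]) auto
  have X': "?X j \<subseteq> ?C j \<and> sum w (?X j) \<le> r" if "j \<in> insert i I" for j
    using that X T by auto
  have XW: "?X j \<subseteq> W" if "j \<in> insert i I" for j
    using X'[OF that] C' that unfolding branch_sets_def by blast
  have "sum w (\<Union>j\<in>insert i I. ?X j) \<le> card (insert i I) * r"
    using X' XW I by (intro boundary_weight) auto
  also have "\<dots> \<le> card J * r"
    using assms(2) I fin r_nonneg by (intro mult_right_mono of_nat_mono card_mono) auto
  finally obtain B' where B': "component E (W - (\<Union>j\<in>insert i I. ?X j)) B'" "sum w W < 2 * sum w B'"
    using heavy XW by blast
  have eq: "(\<Union>j\<in>insert i I. ?X j) = T \<union> (\<Union>j\<in>I. X j)" using assms(2) by auto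
  have "B' \<subseteq> W" using B'(1) by (auto simp: component_def)
  then have "B' \<inter> B \<noteq> {}" using heavy_intersect BW B(2) B'(2) by blast
  then have "B' \<subseteq> B"
    using B'(1) unfolding eq by (intro conn_subset_component[OF _ _ B(1)]) (auto simp: component_def)
  moreover have "B' \<inter> T = {}" using B'(1) unfolding eq by (auto simp: component_def)
  moreover have "T \<noteq> {}" using T(1) by (simp add: conn_def)
  ultimately have "B' \<subset> B" using T(2) by blast
  moreover have "state (insert i I) ?C ?X B'"
    unfolding state_def
  proof (intro conjI ballI)
    fix j assume "j \<in> insert i I"
    then show "?C j \<inter> B' = {}" using X \<open>B' \<subseteq> B\<close> \<open>B' \<inter> T = {}\<close> by auto
  qed (use assms(2) I C' X' B' in auto)
  ultimately show ?thesis by blast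
qed

text \<open>The branch set \<open>C i\<close> that the heavy component \<open>D\<close> no longer sees swallows everything it can
  reach outside \<open>D\<close>; its old boundary is then replaced by a part of the cut \<open>Z\<close>.\<close>

lemma state_cut:
  assumes st: "state I C X B" and "card I < card J"
    and touch: "\<And>i. i \<in> I \<Longrightarrow> E `` C i \<inter> B \<noteq> {}"
    and Z: "Z \<subseteq> B" "sum w Z \<le> r"
    and cut: "\<And>D. conn E D \<Longrightarrow> D \<subseteq> B - Z \<Longrightarrow> \<exists>i\<in>I. D \<inter> E `` C i = {}"
  shows "\<exists>I C X B'. state I C X B' \<and> B' \<subset> B"
proof -
  have I: "I \<subseteq> J" "finite I" using st fin finite_subset by (auto simp: state_def)
  have B: "component E (W - (\<Union>i\<in>I. X i)) B" "sum w W < 2 * sum w B"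
    and C: "branch_sets E W I C"
    and X: "\<And>i. i \<in> I \<Longrightarrow> X i \<subseteq> C i \<and> sum w (X i) \<le> r \<and> C i \<inter> B = {}"
    using st by (auto simp: state_def)
  have BW: "B \<subseteq> W" using B by (auto simp: component_def)
  have finZ: "finite Z" using subset_trans[OF Z(1) BW] fin(1) by (rule finite_subset)
  have XW: "X j \<subseteq> W" if "j \<in> I" for j
    using X[OF that] C that unfolding branch_sets_def by blast
  have weight: "sum w (\<Union>i\<in>I. X i) \<le> card I * r"
    using X XW I by (intro boundary_weight) auto
  \<comment> \<open>The allowance of an index outside \<open>I\<close> pays for \<open>Z\<close>
    while all old boundaries are still in place.\<close>
  have "sum w ((\<Union>i\<in>I. X i) \<union> Z) \<le> sum w (\<Union>i\<in>I. X i) + sum w Z"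
    using I XW finZ fin nonneg by (subst sum_Un) (auto intro!: sum_nonneg intro: finite_subset)
  also have "\<dots> \<le> (card I + 1) * r" using weight Z(2) by (simp add: algebra_simps)
  also have "\<dots> \<le> card J * r"
    using assms(2) r_nonneg by (intro mult_right_mono of_nat_mono) auto
  finally have "sum w ((\<Union>i\<in>I. X i) \<union> Z) \<le> card J * r" .
  moreover have "(\<Union>i\<in>I. X i) \<union> Z \<subseteq> W" using XW Z(1) BW by blast
  ultimately obtain D where D: "component E (W - ((\<Union>i\<in>I. X i) \<union> Z)) D" "sum w W < 2 * sum w D"
    using heavy by blast
  have D1: "conn E D" "D \<subseteq> W - ((\<Union>i\<in>I. X i) \<union> Z)"
    and D2: "\<And>x y. x \<in> D \<Longrightarrow> (x, y) \<in> E \<Longrightarrow> y \<in> W \<Longrightarrow> y \<in> D \<or> y \<in> (\<Union>i\<in>I. X i) \<union> Z"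
    using D(1) by (auto simp: component_def)
  have DW: "D \<subseteq> W" using D1 by blast
  then have "D \<inter> B \<noteq> {}" using heavy_intersect BW B(2) D(2) by blast
  then have DB: "D \<subseteq> B" using D1 by (intro conn_subset_component[OF _ _ B(1)]) auto
  then obtain i where i: "i \<in> I" "D \<inter> E `` C i = {}" using cut[of D] D1 by blast
  have Ci: "conn E (C i)" "C i \<subseteq> W" using C i(1) by (auto simp: branch_sets_def)
  obtain C' where C': "component E (C i \<union> (B - D)) C'" "C i \<subseteq> C'"
    using conn_in_component[OF sym Ci(1), of "C i \<union> (B - D)"] by blast
  have C'1: "conn E C'" "C' \<subseteq> C i \<union> (B - D)"
    and C'2: "\<And>x y. x \<in> C' \<Longrightarrow> (x, y) \<in> E \<Longrightarrow> y \<in> C i \<union> (B - D) \<Longrightarrow> y \<in> C'"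
    using C'(1) by (auto simp: component_def)
  \<comment> \<open>Only this part of \<open>Z\<close> is needed: a vertex of \<open>C'\<close> with
    a neighbour in \<open>D\<close> must lie in \<open>Z\<close>, as checked below.\<close>
  let ?X = "X(i := Z \<inter> C')" and ?C = "C(i := C')"
  have "branch_sets E W (insert i I) ?C"
  proof (intro branch_sets_upd[OF sym C C'1(1)])
    show "C' \<subseteq> W" using C'1(2) Ci(2) BW by blast
    fix j assume j: "j \<in> I - {i}"
    then have "C j \<inter> C i = {}" "E `` C j \<inter> C i \<noteq> {}" using C i(1) by (auto simp: branch_sets_def)
    moreover have "C j \<inter> B = {}" using X j by simp
    ultimately show "C j \<inter> C' = {} \<and> E `` C j \<inter> C' \<noteq> {}" using C'1(2) C'(2) by blast
  qed
  then have bs: "branch_sets E W I ?C" using i(1) by (simp add: insert_absorb)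
  have "sum w (Z \<inter> C') \<le> sum w Z"
    using finZ nonneg by (intro sum_mono2) auto
  then have X': "?X j \<subseteq> ?C j \<and> sum w (?X j) \<le> r" if "j \<in> I" for j
    using that X Z(2) by auto
  have XW': "?X j \<subseteq> W" if "j \<in> I" for j
    using X'[OF that] bs that unfolding branch_sets_def by blast
  have "sum w (\<Union>j\<in>I. ?X j) \<le> card I * r"
    using X' XW' I by (intro boundary_weight) auto
  also have "\<dots> \<le> card J * r"
    using I fin r_nonneg by (intro mult_right_mono of_nat_mono card_mono) auto
  finally obtain B' where B': "component E (W - (\<Union>j\<in>I. ?X j)) B'" "sum w W < 2 * sum w B'"
    using heavy XW' by blast
  have B'1: "conn E B'" "B' \<subseteq> W - (\<Union>j\<in>I. ?X j)" using B'(1) by (auto simp: component_def)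
  have "B' \<subseteq> W" using B'1 by blast
  then have "B' \<inter> D \<noteq> {}" using heavy_intersect DW D(2) B'(2) by blast
  moreover have "D \<inter> C' = {}" using C'1(2) X[OF i(1)] DB by blast
  ultimately have "B' \<inter> (B - C') \<noteq> {}" using DB by blast
  have B'sub: "B' \<subseteq> B - C'"
  proof (rule conn_subset_closed[OF B'1(1) \<open>B' \<inter> (B - C') \<noteq> {}\<close>])
    fix x y assume xy: "x \<in> B'" "x \<in> B - C'" "y \<in> B'" "(x, y) \<in> E"
    have yx: "(y, x) \<in> E" using xy(4) sym by (simp add: symD)
    have y: "y \<in> W" "\<And>j. j \<in> I \<Longrightarrow> y \<notin> ?X j" using B'1(2) xy(3) by blast+
    have "y \<notin> C'"
    proof
      assume yC: "y \<in> C'"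
      \<comment> \<open>Otherwise \<open>x\<close> would be a neighbour of \<open>C'\<close> in
        \<open>B - D\<close> and would have been swallowed.\<close>
      have "x \<in> D" using C'2[OF yC yx] xy(2) by blast
      then have "y \<notin> C i" using i(2) yx by blast
      then have "y \<in> B - D" using C'1(2) yC by blast
      \<comment> \<open>Being adjacent to \<open>D\<close> but outside it, \<open>y\<close> was
        removed; the boundaries miss \<open>B\<close>, which leaves \<open>Z\<close>.\<close>
      then have "y \<in> (\<Union>i\<in>I. X i) \<union> Z" using D2[OF \<open>x \<in> D\<close> xy(4) y(1)] by blast
      moreover have "y \<notin> X j" if "j \<in> I" for j using X[OF that] \<open>y \<in> B - D\<close> by blast
      ultimately have "y \<in> Z" by blast
      then show False using y(2)[OF i(1)] yC by simp
    qed
    moreover have "y \<in> B"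
    proof (rule ccontr)
      assume "y \<notin> B"
      \<comment> \<open>An edge leaves \<open>B\<close> only into an old boundary, and the only one
        given up is \<open>X i\<close>, which lies in \<open>C'\<close>.\<close>
      then obtain j where j: "j \<in> I" "y \<in> X j"
        using B(1) xy(2,4) y(1) unfolding component_def by blast
      then have "j = i" using y(2)[OF j(1)] by (auto split: if_splits)
      then show False using j X[OF i(1)] C'(2) \<open>y \<notin> C'\<close> by blast
    qed
    ultimately show "y \<in> B - C'" by blast
  qed
  \<comment> \<open>Strictness: \<open>C i\<close> touches \<open>B\<close> at a vertex outside
    \<open>D\<close>, and \<open>C'\<close> swallows that vertex.\<close>
  obtain a c where a: "a \<in> B" "c \<in> C i" "(c, a) \<in> E" using touch[OF i(1)] by blast
  then have "a \<in> C'" using C'2[of c a] C'(2) i(2) by blast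
  then have "B' \<subset> B" using B'sub a(1) by blast
  moreover have "state I ?C ?X B'"
    unfolding state_def
  proof (intro conjI ballI)
    fix j assume "j \<in> I"
    then show "?C j \<inter> B' = {}" using X[of j] B'sub by auto
  qed (use I bs X' B' in auto)
  ultimately show ?thesis by blast
qed

text \<open>The two bounds on \<open>r\<close> pay for the two outcomes of
  \<open>tree_or_cut\<close>: a set of at most \<open>card J * (L + 1) + 1\<close> vertices of
  weight at most \<open>d\<close>, or at most \<open>card J\<close> light layers. Without a model on
  \<open>J\<close>, every state would lead to one with smaller \<open>B\<close>, an infinite
  descent.\<close>

lemma branch_sets_exist:
  assumes "0 < L" "\<And>v. v \<in> W \<Longrightarrow> w v \<le> d"
    and r: "real (card J * (L + 1) + 1) * d \<le> r" "card J * sum w W / L \<le> r"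
  shows "\<exists>C. branch_sets E W J C"
proof (rule ccontr)
  assume none: "\<not> ?thesis"
  have step: "\<exists>I C X B'. state I C X B' \<and> B' \<subset> B" if "state I0 C X B" for I0 C X B
  proof -
    let ?I = "{i \<in> I0. E `` C i \<inter> B \<noteq> {}}"
    have st: "state ?I C X B" using state_drop[OF that] .
    \<comment> \<open>If all indices were in use, the branch sets would already be the model assumed
      not to exist.\<close>
    have "?I \<noteq> J" using st none by (auto simp: state_def)
    moreover have "?I \<subseteq> J" using st by (simp add: state_def)
    ultimately have I: "card ?I < card J" "finite ?I" "?I \<subset> J"
      using fin by (auto intro: psubset_card_mono finite_subset)
    have B: "B \<noteq> {}" "B \<subseteq> W" "finite B"
      using st fin finite_subset by (auto simp: state_def component_def conn_def)
    have "0 \<le> d" using B assms(2) nonneg by (meson ex_in_conv order_trans subsetD)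
    have BW: "sum w B \<le> sum w W" using B fin nonneg by (intro sum_mono2) auto
    \<comment> \<open>The targets are the neighbourhoods in \<open>B\<close> of the branch sets: a
      tree meeting them all is adjacent to every branch set, and a piece missing one no longer sees
      that branch set.\<close>
    show ?thesis
    proof (rule tree_or_cut[where w = w and A = "\<lambda>i. E `` C i \<inter> B", OF sym B(3,1) I(2) assms(1) nonneg])
      fix T assume T: "T \<subseteq> B" "conn E T" "card T \<le> card ?I * (L + 1) + 1"
        "\<And>i. i \<in> ?I \<Longrightarrow> T \<inter> (E `` C i \<inter> B) \<noteq> {}"
      have "sum w T \<le> (\<Sum>v\<in>T. d)" using T(1) B(2) assms(2) by (intro sum_mono) auto
      also have "\<dots> = real (card T) * d" by simp
      also have "\<dots> \<le> real (card J * (L + 1) + 1) * d"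
      proof (intro mult_right_mono of_nat_mono)
        have "card ?I * (L + 1) \<le> card J * (L + 1)" using I(1) by (intro mult_right_mono) auto
        then show "card T \<le> card J * (L + 1) + 1" using T(3) by linarith
      qed fact
      finally have wT: "sum w T \<le> r" using r(1) by linarith
      obtain i where "i \<in> J - ?I" using I(3) by blast
      then show ?thesis by (rule state_extend[OF st _ T(2,1) wT]) (use T(4) in blast)
    next
      fix Z assume Z: "Z \<subseteq> B" "sum w Z \<le> card ?I * (sum w B / L)"
        "\<And>D. conn E D \<Longrightarrow> D \<subseteq> B - Z \<Longrightarrow> \<exists>i\<in>?I. D \<inter> (E `` C i \<inter> B) = {}"
      have "card ?I * (sum w B / L) \<le> card J * (sum w W / L)"
        using I(1) BW nonneg by (intro mult_mono divide_right_mono) (auto intro!: divide_nonneg_nonneg sum_nonneg)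
      then have wZ: "sum w Z \<le> r" using Z(2) r(2) by simp
      show ?thesis
      proof (rule state_cut[OF st I(1) _ Z(1) wZ])
        fix D assume D: "conn E D" "D \<subseteq> B - Z"
        show "\<exists>i\<in>?I. D \<inter> E `` C i = {}" using Z(3)[OF D] D(2) by blast
      qed simp
    qed simp
  qed
  have minimal: "\<not> state I C X B" if "finite B" for I C X B
    using that
  proof (induction B arbitrary: I C X rule: finite_psubset_induct)
    case (psubset B)
    show ?case
    proof
      assume "state I C X B"
      from step[OF this] obtain I' C' X' B' where B': "state I' C' X' B'" "B' \<subset> B"
        by (elim exE conjE)
      show False by (rule notE[OF psubset.IH[OF B'(2)] B'(1)])
    qed
  qed
  obtain B where B: "state {} (\<lambda>_. {}) (\<lambda>_. {}) B" using state_initial ..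
  then have "B \<subseteq> W" by (auto simp: state_def component_def)
  then have "finite B" using fin(1) by (rule finite_subset)
  from minimal[OF this] B show False by (rule notE)
qed

end

text \<open>If every cheap \<open>X\<close> left a connected set with more than half of the weight,
  the component around it would be as heavy. That is the hypothesis of
  \<open>heavy_components\<close>, whose descent yields the excluded clique model.\<close>

lemma balanced_separator:
  fixes w :: "'a \<Rightarrow> real" and d r :: real and J :: "'b set"
  assumes "sym E" "finite W" "finite J" "\<And>v. 0 \<le> w v" "\<And>v. v \<in> W \<Longrightarrow> w v \<le> d" "0 < L"
    and r: "real (card J * (L + 1) + 1) * d \<le> r" "card J * sum w W / L \<le> r"
    and none: "\<not> (\<exists>C. branch_sets E W J C)"
  shows "\<exists>X\<subseteq>W. sum w X \<le> card J * r \<and> (\<forall>K. conn E K \<and> K \<subseteq> W - X \<longrightarrow> 2 * sum w K \<le> sum w W)"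
proof (rule ccontr)
  assume contra: "\<not> ?thesis"
  have heavy: "\<exists>B. component E (W - X) B \<and> sum w W < 2 * sum w B"
    if X: "X \<subseteq> W" "sum w X \<le> card J * r" for X
  proof -
    obtain K where K: "conn E K" "K \<subseteq> W - X" "sum w W < 2 * sum w K" using contra X by force
    obtain B where B: "component E (W - X) B" "K \<subseteq> B" by (rule conn_in_component[OF assms(1) K(1,2)])
    have "finite B" using B(1) assms(2) finite_subset by (auto simp: component_def)
    then have "sum w K \<le> sum w B" using B(2) assms(4) by (intro sum_mono2) auto
    then show ?thesis using B K(3) by force
  qed
  have "0 \<le> card J * sum w W / L"
    using assms(4) by (intro divide_nonneg_nonneg mult_nonneg_nonneg sum_nonneg) auto
  then have "0 \<le> r" using r(2) by linarith
  then interpret heavy_components E W w r J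
    using assms(1-4) heavy by unfold_locales
  show False using branch_sets_exist[OF assms(6,5) r] none by blast
qed

section \<open>Iterating separators down to light pieces\<close>

text \<open>The quadratic bound makes the recursion close: halving the weight of every piece
  at least halves the sum of the squares of the weights.\<close>

lemma cheap_shattering:
  fixes w :: "'a \<Rightarrow> real" and d r :: real and J :: "'b set"
  assumes "sym E" "finite V" "finite J" "\<And>v. 0 \<le> w v" "\<And>v. v \<in> V \<Longrightarrow> w v \<le> d" "0 < L" "0 < t"
    and r: "real (card J * (L + 1) + 1) * d \<le> r" "card J * sum w V / L \<le> r"
    and none: "\<not> (\<exists>C. branch_sets E V J C)"
  shows "\<exists>X\<subseteq>V. sum w X \<le> 2 * card J * r / t\<^sup>2 * (sum w V)\<^sup>2 \<and>
    (\<forall>K. conn E K \<and> K \<subseteq> V - X \<longrightarrow> sum w K \<le> t)"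
proof -
  define s where "s = card J * r"
  \<comment> \<open>Chosen so that \<open>s = c * t\<^sup>2 / 2\<close>: a set heavier than
    \<open>t\<close> pays for its separator with half of its allowance
    \<open>c * (sum w W)\<^sup>2\<close>.\<close>
  define c where "c = 2 * s / t\<^sup>2"
  have "0 \<le> card J * sum w V / L" using assms(4) by (intro divide_nonneg_nonneg mult_nonneg_nonneg sum_nonneg) auto
  then have "0 \<le> s" using r(2) by (auto simp: s_def)
  then have c: "0 \<le> c" by (simp add: c_def)
  have "\<exists>X\<subseteq>W. sum w X \<le> c * (sum w W)\<^sup>2 \<and> (\<forall>K. conn E K \<and> K \<subseteq> W - X \<longrightarrow> sum w K \<le> t)"
    if "finite W" "W \<subseteq> V" for W
    using that
  proof (induction W rule: finite_psubset_induct)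
    case (psubset W)
    show ?case
    proof (cases "sum w W \<le> t")
      case True
      have "sum w K \<le> t" if "K \<subseteq> W" for K
        using sum_mono2[OF psubset.hyps that, of w] assms(4) True by fastforce
      then show ?thesis using c by (intro exI[of _ "{}"]) auto
    next
      case False
      \<comment> \<open>The same \<open>r\<close> serves every subset \<open>W\<close>: its weight
        is no larger, and a clique model in \<open>W\<close> is one in \<open>V\<close>.\<close>
      have "sum w W \<le> sum w V" using psubset.prems assms(2,4) by (intro sum_mono2) auto
      then have "card J * sum w W / L \<le> card J * sum w V / L"
        by (intro divide_right_mono mult_left_mono) auto
      then have rW: "card J * sum w W / L \<le> r" using r(2) by linarith
      have noneW: "\<not> (\<exists>C. branch_sets E W J C)"
      proof
        assume "\<exists>C. branch_sets E W J C"
        then obtain C where "branch_sets E W J C" by blast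
        then have "branch_sets E V J C" using psubset.prems unfolding branch_sets_def by blast
        then show False using none by blast
      qed
      have lightW: "\<And>v. v \<in> W \<Longrightarrow> w v \<le> d" using assms(5) psubset.prems by blast
      have "\<exists>X\<subseteq>W. sum w X \<le> card J * r \<and>
          (\<forall>K. conn E K \<and> K \<subseteq> W - X \<longrightarrow> 2 * sum w K \<le> sum w W)"
        by (rule balanced_separator[OF assms(1) psubset.hyps assms(3,4) _ assms(6) r(1) rW noneW]) (rule lightW)
      then obtain X where X: "X \<subseteq> W" "sum w X \<le> s"
        and "\<forall>K. conn E K \<and> K \<subseteq> W - X \<longrightarrow> 2 * sum w K \<le> sum w W"
        unfolding s_def by (elim exE conjE)
      then have halves: "\<And>K. conn E K \<Longrightarrow> K \<subseteq> W - X \<Longrightarrow> 2 * sum w K \<le> sum w W" by simp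
      let ?K = "{K. component E (W - X) K}"
      have part: "partition_on (W - X) ?K" by (rule components_partition[OF assms(1)])
      have finK: "finite ?K" using finite_elements[OF _ part] psubset.hyps by blast
      have half: "2 * sum w K \<le> sum w W" and KW: "K \<subseteq> W - X" if "K \<in> ?K" for K
        using that halves by (auto simp: component_def)
      have "\<forall>K\<in>?K. \<exists>Y\<subseteq>K. sum w Y \<le> c * (sum w K)\<^sup>2 \<and>
          (\<forall>D. conn E D \<and> D \<subseteq> K - Y \<longrightarrow> sum w D \<le> t)"
      proof
        fix K assume K: "K \<in> ?K"
        have "K \<noteq> W" using half[OF K] False assms(7) by auto
        then have "K \<subset> W" using KW[OF K] by blast
        then show "\<exists>Y\<subseteq>K. sum w Y \<le> c * (sum w K)\<^sup>2 \<and>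
            (\<forall>D. conn E D \<and> D \<subseteq> K - Y \<longrightarrow> sum w D \<le> t)"
          using psubset.prems by (intro psubset.IH) auto
      qed
      from bchoice[OF this] obtain Y where Y': "\<forall>K\<in>?K. Y K \<subseteq> K \<and> sum w (Y K) \<le> c * (sum w K)\<^sup>2 \<and>
          (\<forall>D. conn E D \<and> D \<subseteq> K - Y K \<longrightarrow> sum w D \<le> t)" ..
      have Y: "Y K \<subseteq> K" "sum w (Y K) \<le> c * (sum w K)\<^sup>2"
          "\<And>D. conn E D \<Longrightarrow> D \<subseteq> K - Y K \<Longrightarrow> sum w D \<le> t" if "K \<in> ?K" for K
        using bspec[OF Y' that] by auto
      have finY: "finite (Y K)" if "K \<in> ?K" for K
        using Y(1)[OF that] KW[OF that] psubset.hyps by (meson finite_Diff finite_subset)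
      have "sum w (\<Union>K\<in>?K. Y K) \<le> (\<Sum>K\<in>?K. sum w (Y K))"
        using finY by (intro sum_UN_le finK assms(4))
      \<comment> \<open>One factor of each square is bounded by half of \<open>sum w W\<close>; the
        other factors add up to at most \<open>sum w W\<close>. So the pieces use the second half of
        the allowance.\<close>
      also have "\<dots> \<le> (\<Sum>K\<in>?K. c * (sum w W / 2) * sum w K)"
      proof (rule sum_mono)
        fix K assume K: "K \<in> ?K"
        have "(sum w K)\<^sup>2 \<le> (sum w W / 2) * sum w K"
          using half[OF K] assms(4) unfolding power2_eq_square
          by (intro mult_right_mono) (auto intro: sum_nonneg)
        then have "c * (sum w K)\<^sup>2 \<le> c * ((sum w W / 2) * sum w K)" using c by (rule mult_left_mono)
        then show "sum w (Y K) \<le> c * (sum w W / 2) * sum w K" using Y(2)[OF K] by (simp add: mult.assoc)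
      qed
      also have "\<dots> = c * (sum w W / 2) * (\<Sum>K\<in>?K. sum w K)" by (simp add: sum_distrib_left)
      also have "(\<Sum>K\<in>?K. sum w K) = sum w (W - X)"
        using part KW psubset.hyps
        by (subst (2) partition_onD1[OF part], subst sum.Union_disjoint)
           (auto simp: partition_on_def disjoint_def intro: finite_subset)
      also have "c * (sum w W / 2) * sum w (W - X) \<le> c * (sum w W / 2) * sum w W"
        using c assms(4) psubset.hyps
        by (intro mult_left_mono sum_mono2 mult_nonneg_nonneg divide_nonneg_nonneg sum_nonneg) auto
      finally have wY: "sum w (\<Union>K\<in>?K. Y K) \<le> c * (sum w W)\<^sup>2 / 2"
        by (simp add: power2_eq_square)
      have "s = c * t\<^sup>2 / 2" using assms(7) by (simp add: c_def)
      also have "\<dots> \<le> c * (sum w W)\<^sup>2 / 2"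
        using False assms(7) c by (intro divide_right_mono mult_left_mono power_mono) auto
      finally have wX: "sum w X \<le> c * (sum w W)\<^sup>2 / 2" using X(2) by linarith
      let ?X = "X \<union> (\<Union>K\<in>?K. Y K)"
      have XW: "?X \<subseteq> W" using X(1) Y(1) KW by blast
      have "sum w ?X \<le> sum w X + sum w (\<Union>K\<in>?K. Y K)"
        using X(1) psubset.hyps finK finY assms(4)
        by (subst sum_Un) (auto intro!: sum_nonneg intro: finite_subset)
      then have "sum w ?X \<le> c * (sum w W)\<^sup>2" using wX wY by linarith
      moreover have "sum w D \<le> t" if D: "conn E D" "D \<subseteq> W - ?X" for D
      proof -
        \<comment> \<open>A connected set avoiding \<open>X\<close> lies in a single piece, where
          the induction hypothesis applies.\<close>
        have "D \<subseteq> W - X" using D(2) by blast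
        then obtain K where K: "component E (W - X) K" "D \<subseteq> K"
          using conn_in_component[OF assms(1) D(1)] by blast
        have "D \<subseteq> K - Y K" using K D(2) by blast
        then show ?thesis using Y(3)[of K D] K(1) D(1) by simp
      qed
      ultimately show ?thesis using XW by blast
    qed
  qed
  from this[OF assms(2) subset_refl] show ?thesis unfolding c_def s_def by (simp add: mult.assoc)
qed

section \<open>Modularity\<close>

definition adj :: "'a graph \<Rightarrow> 'a rel" where
  "adj G = {(x, y). {x, y} \<in> edges G}"

lemma sym_adj: "sym (adj G)"
  by (auto simp: adj_def sym_def insert_commute)

lemma connected_graph_induced: "connected_graph (induced_subgraph G S) \<longleftrightarrow> conn (adj G) S"
proof -
  have "{(x, y). {x, y} \<in> edges (induced_subgraph G S)} = Restr (adj G) S"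
    by (auto simp: induced_subgraph_def adj_def)
  then show ?thesis unfolding connected_graph_def conn_def by (simp add: induced_subgraph_def)
qed

lemma branch_sets_is_minor:
  assumes "simple_graph H" "branch_sets (adj G) (verts G) (verts H) C"
  shows "is_minor H G"
  unfolding is_minor_def
proof (intro exI[of _ C] conjI ballI allI impI)
  fix x y assume e: "{x, y} \<in> edges H"
  \<comment> \<open>Simplicity of \<open>H\<close> rules out \<open>x = y\<close>, for which
    \<open>branch_sets\<close> promises no edge.\<close>
  then have "{x, y} \<subseteq> verts H" "card {x, y} = 2" using assms(1) by (auto simp: simple_graph_def)
  then have "x \<in> verts H" "y \<in> verts H" "x \<noteq> y" by auto
  then have "adj G `` C x \<inter> C y \<noteq> {}" using assms(2) by (simp add: branch_sets_def)
  then show "\<exists>u\<in>C x. \<exists>v\<in>C y. {u, v} \<in> edges G" by (auto simp: adj_def)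
qed (use assms(2) in \<open>auto simp: branch_sets_def connected_graph_induced disjoint_family_on_def\<close>)

section \<open>Degree sums and a lower bound on modularity\<close>

lemma finite_edges:
  assumes "simple_graph G"
  shows "finite (edges G)"
  using assms by (intro finite_subset[of "edges G" "Pow (verts G)"]) (auto simp: simple_graph_def)

lemma handshake:
  assumes "simple_graph G"
  shows "degree_sum G (verts G) = 2 * card (edges G)"
proof -
  have fin: "finite (verts G)" "finite (edges G)" using assms finite_edges by (auto simp: simple_graph_def)
  have "{v \<in> verts G. v \<in> e} = e" "card e = 2" if "e \<in> edges G" for e
    using that assms by (auto simp: simple_graph_def)
  then have "(\<Sum>v\<in>verts G. card {e \<in> edges G. v \<in> e}) = 2 * card (edges G)"
    using fin by (intro sum_multicount) auto
  then show ?thesis by (simp add: degree_sum_def degree_def)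
qed

lemma degree_le_max_degree:
  assumes "simple_graph G" "v \<in> verts G"
  shows "degree G v \<le> max_degree G"
  using assms by (auto simp: max_degree_def simple_graph_def intro: Max_ge)

lemma sum_degree: "(\<Sum>v\<in>S. real (degree G v)) = degree_sum G S"
  by (simp add: degree_sum_def)

text \<open>Take the singletons of \<open>X\<close> and the components of the rest. An edge inside
  no part has an end in \<open>X\<close>, so at most \<open>degree_sum G X\<close> edges are lost.
  Every part has degree sum at most \<open>t\<close>; bounding one factor of each square by this and
  summing the other to 1 gives the last term.\<close>

lemma modularity_ge:
  assumes G: "simple_graph G" "edges G \<noteq> {}" and X: "X \<subseteq> verts G"
    and deg: "\<And>v. v \<in> verts G \<Longrightarrow> real (degree G v) \<le> t"
    and pieces: "\<And>K. conn (adj G) K \<Longrightarrow> K \<subseteq> verts G - X \<Longrightarrow> real (degree_sum G K) \<le> t"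
  shows "1 - degree_sum G X / card (edges G) - t / (2 * real (card (edges G))) \<le> modularity G"
proof -
  let ?E = "edges G" and ?V = "verts G"
  let ?P = "(\<lambda>x. {x}) ` X \<union> {K. component (adj G) (?V - X) K}"
  have fin: "finite ?V" "finite ?E" using G finite_edges by (auto simp: simple_graph_def)
  have m: "0 < real (card ?E)" using fin G(2) by (simp add: card_gt_0_iff)
  have P: "partition_on ?V ?P"
  proof -
    let ?A = "(\<lambda>x. {x}) ` X" and ?B = "{K. component (adj G) (?V - X) K}"
    have A: "\<Union>?A = X" "disjoint ?A" "{} \<notin> ?A"
      using partition_on_singletons[of X] by (auto simp: partition_on_def)
    have B: "\<Union>?B = ?V - X" "disjoint ?B" "{} \<notin> ?B"
      using components_partition[OF sym_adj, of "?V - X" G] unfolding partition_on_def by blast+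
    have "\<Union>(?A \<union> ?B) = ?V" using A(1) B(1) X by (simp only: Union_Un_distrib) blast
    moreover have "disjoint (?A \<union> ?B)" using A B by (intro disjoint_union) (simp_all only:, blast)
    ultimately show ?thesis using A(3) B(3) by (simp only: partition_on_def) simp
  qed
  have finP: "finite ?P" by (rule finite_elements[OF fin(1) P])
  have small: "real (degree_sum G A) \<le> t" if "A \<in> ?P" for A
    using that
  proof
    assume "A \<in> (\<lambda>x. {x}) ` X"
    then show ?thesis using deg X by (auto simp: degree_sum_def)
  next
    assume "A \<in> {K. component (adj G) (?V - X) K}"
    then show ?thesis using pieces by (auto simp: component_def)
  qed
  have "?E \<subseteq> (\<Union>A\<in>?P. edges (induced_subgraph G A)) \<union> (\<Union>x\<in>X. {e \<in> ?E. x \<in> e})"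
  proof
    fix e assume e: "e \<in> ?E"
    then have "e \<subseteq> ?V" "card e = 2" using G(1) by (auto simp: simple_graph_def)
    then obtain x y where xy: "e = {x, y}" "x \<in> ?V" "y \<in> ?V" by (auto simp: card_2_iff)
    show "e \<in> (\<Union>A\<in>?P. edges (induced_subgraph G A)) \<union> (\<Union>x\<in>X. {e \<in> ?E. x \<in> e})"
    proof (cases "x \<in> X \<or> y \<in> X")
      case True
      then show ?thesis using e xy by auto
    next
      case False
      then obtain K where K: "component (adj G) (?V - X) K" "x \<in> K"
        using component_exists[OF sym_adj, of x "?V - X"] xy by blast
      moreover have "(x, y) \<in> adj G" using e xy by (simp add: adj_def)
      ultimately have "y \<in> K" using False xy unfolding component_def by blast
      then have "e \<in> edges (induced_subgraph G K)" using e xy K(2) by (simp add: induced_subgraph_def)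
      then show ?thesis using K(1) by blast
    qed
  qed
  then have "card ?E \<le> card ((\<Union>A\<in>?P. edges (induced_subgraph G A)) \<union> (\<Union>x\<in>X. {e \<in> ?E. x \<in> e}))"
    using fin finP X by (intro card_mono) (auto simp: induced_subgraph_def intro: finite_subset)
  also have "\<dots> \<le> card (\<Union>A\<in>?P. edges (induced_subgraph G A)) + card (\<Union>x\<in>X. {e \<in> ?E. x \<in> e})"
    by (rule card_Un_le)
  also have "\<dots> \<le> (\<Sum>A\<in>?P. card (edges (induced_subgraph G A))) + (\<Sum>x\<in>X. card {e \<in> ?E. x \<in> e})"
    using finite_subset[OF X fin(1)] by (intro add_mono card_UN_le finP)
  also have "(\<Sum>x\<in>X. card {e \<in> ?E. x \<in> e}) = degree_sum G X" by (simp add: degree_sum_def degree_def)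
  finally have "real (card ?E) \<le> (\<Sum>A\<in>?P. real (card (edges (induced_subgraph G A)))) + degree_sum G X"
    by (metis of_nat_add of_nat_le_iff of_nat_sum)
  then have "real (card ?E) - degree_sum G X \<le> (\<Sum>A\<in>?P. real (card (edges (induced_subgraph G A))))"
    by linarith
  then have "(real (card ?E) - degree_sum G X) / card ?E
      \<le> (\<Sum>A\<in>?P. real (card (edges (induced_subgraph G A)))) / card ?E"
    by (rule divide_right_mono) simp
  then have cov: "1 - degree_sum G X / card ?E
      \<le> (\<Sum>A\<in>?P. real (card (edges (induced_subgraph G A))) / card ?E)"
    using m by (simp add: diff_divide_distrib sum_divide_distrib)
  have total: "(\<Sum>A\<in>?P. real (degree_sum G A)) = 2 * real (card ?E)"
  proof -
    have "(\<Sum>A\<in>?P. degree_sum G A) = degree_sum G ?V"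
    proof -
      have "\<forall>A\<in>?P. finite A" using P fin(1) by (auto simp: partition_on_def intro: finite_subset)
      moreover have "\<forall>A\<in>?P. \<forall>B\<in>?P. A \<noteq> B \<longrightarrow> A \<inter> B = {}"
        using partition_onD2[OF P] by (simp only: disjoint_def)
      ultimately have "sum (degree G) (\<Union>?P) = (\<Sum>A\<in>?P. sum (degree G) A)"
        by (subst sum.Union_disjoint) auto
      then show ?thesis using partition_onD1[OF P] by (simp add: degree_sum_def)
    qed
    then show ?thesis using handshake[OF G(1)] by (metis of_nat_mult of_nat_numeral of_nat_sum)
  qed
  have "(\<Sum>A\<in>?P. (real (degree_sum G A) / (2 * real (card ?E)))\<^sup>2)
      \<le> (\<Sum>A\<in>?P. t / (2 * real (card ?E)) * (real (degree_sum G A) / (2 * real (card ?E))))"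
    using small unfolding power2_eq_square
    by (intro sum_mono mult_right_mono divide_right_mono) auto
  also have "\<dots> = t / (2 * real (card ?E)) * ((\<Sum>A\<in>?P. real (degree_sum G A)) / (2 * real (card ?E)))"
    by (simp only: sum_distrib_left sum_divide_distrib)
  also have "\<dots> = t / (2 * real (card ?E))" using total m by simp
  finally have tax: "(\<Sum>A\<in>?P. (real (degree_sum G A) / (2 * real (card ?E)))\<^sup>2) \<le> t / (2 * real (card ?E))" .
  have "partition_modularity G ?P = (\<Sum>A\<in>?P. real (card (edges (induced_subgraph G A))) / card ?E)
      - (\<Sum>A\<in>?P. (real (degree_sum G A) / (2 * real (card ?E)))\<^sup>2)"
    unfolding partition_modularity_def handshake[OF G(1)] sum_subtractf by simp
  moreover have "partition_modularity G ?P \<le> modularity G"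
    using G P partitions_finite_nonempty(1)[OF G(1)] by (auto simp: modularity_def intro: Max_ge)
  ultimately show ?thesis using cov tax by linarith
qed

section \<open>Choice of the constants and conclusion\<close>

theorem theorem4:
  fixes H :: "'b graph" and C :: "'a graph set"
  assumes "simple_graph H"
    and "\<And>G. G \<in> C \<Longrightarrow> simple_graph G"
    and "\<And>G. G \<in> C \<Longrightarrow> \<not> is_minor H G"
    and "\<And>\<delta>::real. \<delta> > 0 \<Longrightarrow>
           \<exists>m\<^sub>\<delta>::nat. \<forall>G\<in>C. card (edges G) \<ge> m\<^sub>\<delta> \<longrightarrow>
             real (max_degree G) \<le> \<delta> * real (card (edges G))"
  shows "\<forall>\<epsilon>::real. \<epsilon> > 0 \<longrightarrow>
           (\<exists>M\<^sub>\<epsilon>::nat. \<forall>G\<in>C. card (edges G) \<ge> M\<^sub>\<epsilon> \<longrightarrow> modularity G > 1 - \<epsilon>)"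
proof (intro allI impI)
  fix \<epsilon> :: real assume \<epsilon>: "\<epsilon> > 0"
  define h where "h = card (verts H)"
  \<comment> \<open>With \<open>m\<close> edges, \<open>cheap_shattering\<close> is applied with
    \<open>r = \<gamma> * m\<close>, \<open>t = \<epsilon> * m\<close> and total weight
    \<open>2 * m\<close>. The cost \<open>8 * h * \<gamma> * m / \<epsilon>^2\<close> of
    \<open>X\<close> is then at most \<open>\<epsilon> * m / 4\<close>; \<open>h + 1\<close> avoids
    division by zero.\<close>
  define \<gamma> where "\<gamma> = \<epsilon> ^ 3 / (32 * (real h + 1))"
  \<comment> \<open>Makes the layers affordable, \<open>h * (2 * m) / L \<le> \<gamma> * m\<close>;
    the \<open>+ 1\<close> keeps \<open>L\<close> positive even for \<open>h = 0\<close>.\<close>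
  define L where "L = nat \<lceil>2 * h / \<gamma>\<rceil> + 1"
  \<comment> \<open>The first term makes the small trees affordable, the second controls the
    singleton parts.\<close>
  define \<delta> where "\<delta> = min (\<gamma> / real (h * (L + 1) + 1)) \<epsilon>"
  have \<gamma>: "\<gamma> > 0" using \<epsilon> by (simp add: \<gamma>_def)
  have L: "0 < L" "2 * h / \<gamma> \<le> L" unfolding L_def by linarith+
  have \<delta>: "\<delta> > 0" "\<delta> \<le> \<epsilon>" "real (h * (L + 1) + 1) * \<delta> \<le> \<gamma>"
  proof -
    have k: "0 < real (h * (L + 1) + 1)" by linarith
    then show "\<delta> > 0" using \<gamma> \<epsilon> unfolding \<delta>_def by (intro min_less_iff_conj[THEN iffD2] conjI divide_pos_pos)
    show "\<delta> \<le> \<epsilon>" by (simp add: \<delta>_def)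
    have "\<delta> \<le> \<gamma> / real (h * (L + 1) + 1)" unfolding \<delta>_def by (rule min.cobounded1)
    then show "real (h * (L + 1) + 1) * \<delta> \<le> \<gamma>" using k by (simp only: pos_le_divide_eq mult.commute)
  qed
  obtain m0 where m0: "\<And>G. G \<in> C \<Longrightarrow> card (edges G) \<ge> m0 \<Longrightarrow> max_degree G \<le> \<delta> * card (edges G)"
    using assms(4)[OF \<delta>(1)] by blast
  \<comment> \<open>The 1 in the threshold ensures that \<open>G\<close> has an edge.\<close>
  have "modularity G > 1 - \<epsilon>" if G: "G \<in> C" "card (edges G) \<ge> max m0 1" for G
  proof -
    define m where "m = real (card (edges G))"
    have m: "m > 0" using G(2) by (simp add: m_def)
    have ne: "edges G \<noteq> {}" using G(2) by auto
    have sg: "simple_graph G" using assms(2) G(1) .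
    have deg: "real (degree G v) \<le> \<delta> * m" if "v \<in> verts G" for v
      using degree_le_max_degree[OF sg that] m0[OF G(1)] G(2) by (simp add: m_def)
    have total: "(\<Sum>v\<in>verts G. real (degree G v)) = 2 * m"
      using handshake[OF sg] by (simp only: sum_degree m_def)
    have r1: "real (card (verts H) * (L + 1) + 1) * (\<delta> * m) \<le> \<gamma> * m"
      using mult_right_mono[OF \<delta>(3), of m] m unfolding h_def by (simp only: mult.assoc less_imp_le)
    have "2 * h \<le> \<gamma> * L" using L(2) \<gamma> by (simp add: pos_divide_le_eq mult.commute)
    then have "2 * h * m \<le> \<gamma> * L * m" using m by (intro mult_right_mono) auto
    then have r2: "real (card (verts H)) * (\<Sum>v\<in>verts G. real (degree G v)) / L \<le> \<gamma> * m"
      unfolding total h_def using L(1) by (simp add: pos_divide_le_eq mult_ac)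
    have none: "\<not> (\<exists>B. branch_sets (adj G) (verts G) (verts H) B)"
      using branch_sets_is_minor[OF assms(1)] assms(3)[OF G(1)] by blast
    have fin: "finite (verts G)" "finite (verts H)" using sg assms(1) by (auto simp: simple_graph_def)
    have "\<exists>X\<subseteq>verts G. (\<Sum>v\<in>X. real (degree G v))
          \<le> 2 * card (verts H) * (\<gamma> * m) / (\<epsilon> * m)\<^sup>2 * (\<Sum>v\<in>verts G. real (degree G v))\<^sup>2 \<and>
        (\<forall>K. conn (adj G) K \<and> K \<subseteq> verts G - X \<longrightarrow> (\<Sum>v\<in>K. real (degree G v)) \<le> \<epsilon> * m)"
      using \<epsilon> m deg by (intro cheap_shattering[OF sym_adj fin _ _ L(1) _ r1 r2 none]) auto
    then obtain X where X: "X \<subseteq> verts G"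
        "real (degree_sum G X) \<le> 2 * h * (\<gamma> * m) / (\<epsilon> * m)\<^sup>2 * (2 * m)\<^sup>2"
        "\<forall>K. conn (adj G) K \<and> K \<subseteq> verts G - X \<longrightarrow> real (degree_sum G K) \<le> \<epsilon> * m"
      unfolding total[unfolded sum_degree] sum_degree h_def of_nat_mult of_nat_numeral by (elim exE conjE)
    have "2 * h * (\<gamma> * m) / (\<epsilon> * m)\<^sup>2 * (2 * m)\<^sup>2 = h / (real h + 1) * (\<epsilon> * m / 4)"
    proof -
      have "2 * real h * (a / (32 * k) * m) / (\<epsilon> * m)\<^sup>2 * (2 * m)\<^sup>2 = h / k * (\<epsilon> * m / 4)"
        if "a = \<epsilon> ^ 3" "k > 0" for a k :: real
        using that m \<epsilon> by (simp add: field_simps power2_eq_square power3_eq_cube)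
      from this[of "\<epsilon> ^ 3" "real h + 1"] show ?thesis unfolding \<gamma>_def by simp
    qed
    also have "\<dots> \<le> 1 * (\<epsilon> * m / 4)" using m \<epsilon> by (intro mult_right_mono) auto
    finally have "degree_sum G X \<le> \<epsilon> * m / 4" using X(2) by simp
    then have "degree_sum G X / m \<le> \<epsilon> / 4" using m by (simp add: pos_divide_le_eq)
    moreover have "\<epsilon> * m / (2 * m) = \<epsilon> / 2" using m by simp
    moreover have "1 - degree_sum G X / m - \<epsilon> * m / (2 * m) \<le> modularity G"
      unfolding m_def
    proof (rule modularity_ge[OF sg ne X(1)])
      fix v assume "v \<in> verts G"
      moreover have "\<delta> * m \<le> \<epsilon> * m" using \<delta>(2) m by (intro mult_right_mono) auto
      ultimately show "real (degree G v) \<le> \<epsilon> * card (edges G)"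
        using deg unfolding m_def by fastforce
    qed (use X(3) in \<open>auto simp: m_def\<close>)
    \<comment> \<open>The loss is at most \<open>\<epsilon> / 4\<close> from edges and
      \<open>\<epsilon> / 2\<close> from squares, together below \<open>\<epsilon>\<close>.\<close>
    ultimately show ?thesis using \<epsilon> by linarith
  qed
  then show "\<exists>M\<^sub>\<epsilon>::nat. \<forall>G\<in>C. card (edges G) \<ge> M\<^sub>\<epsilon> \<longrightarrow> modularity G > 1 - \<epsilon>" by blast
qed

end
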